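(* Let $m,n$ be positive integers, $a,b$ non-negative integers with $a+b=n$ and $a$ even, and $x,y$ complex numbers with $ax+by=0$. Define \[ R_{2,4}(x,y;m,n;\tau)= mn\, q^{\frac{a}{4}}\sum_{\substack{r_1,\ldots,r_a,s_1,\ldots,s_b\in\mathbb{Z}\\ 2(r_1+\cdots+r_a+s_1+\cdots+s_b)+a=0}}(-1)^{s_1+\cdots+s_b}q^{r_1^2+\cdots+r_a^2+s_1^2+\cdots+s_b^2+r_1+\cdots+r_a}e^{i(2(r_1+\cdots+r_a)x+2(s_1+\cdots+s_b)y+ax)}. \] Let $S(z)=\sum_{k=0}^{mn-1}\vartheta_2^{a}\!\left(z+x+\tfrac{k\pi}{mn}\Big|\tau\right)\vartheta_4^{b}\!\left(z+y+\tfrac{k\pi}{mn}\Big|\tau\right)$. Then for all $z\in\mathbb{C}$: if $mb$ is even, $S(z)=R_{2,4}(x,y;m,n;\tau)\,\vartheta_3(mnz\,|\,m^2n\tau)$; if $mb$ is odd, $S(z)=R_{2,4}(x,y;m,n;\tau)\,\vartheta_4(mnz\,|\,m^2n\tau)$.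
   Context: Throughout, $\tau\in\mathbb{C}$ with $\Im(\tau)>0$, $q=e^{\pi i\tau}$, and $q^{\alpha}$ means $e^{\pi i\alpha\tau}$ for real $\alpha$. The Jacobi theta functions are $\vartheta_2(z|\tau)=q^{1/4}\sum_{n\in\mathbb{Z}}q^{n(n+1)}e^{(2n+1)iz}$, $\vartheta_3(z|\tau)=\sum_{n\in\mathbb{Z}}q^{n^2}e^{2niz}$, $\vartheta_4(z|\tau)=\sum_{n\in\mathbb{Z}}(-1)^nq^{n^2}e^{2niz}$; and $\vartheta_j(z|m^2n\tau)$ denotes the same function with $\tau$ replaced by $m^2n\tau$. A zeroth power equals $1$. *)

theory Defs
  imports "HOL-Analysis.Analysis"
begin

text \<open>\<open>qpow \<tau> \<alpha>\<close> is \<open>q\<close> raised to the real power \<open>\<alpha>\<close>, where \<open>q = exp (\<pi> \<i> \<tau>)\<close>; the branch is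
  the one fixed by \<open>\<tau>\<close>, which in general differs from \<open>q powr \<alpha>\<close>.\<close>

definition qpow :: "complex \<Rightarrow> real \<Rightarrow> complex" where
  "qpow \<tau> \<alpha> = exp (complex_of_real pi * \<i> * complex_of_real \<alpha> * \<tau>)"

definition theta2 :: "complex \<Rightarrow> complex \<Rightarrow> complex" where
  "theta2 z \<tau> = qpow \<tau> (1/4) *
     (\<Sum>\<^sub>\<infinity>n\<in>(UNIV :: int set). qpow \<tau> (of_int (n * (n + 1))) * exp (of_int (2 * n + 1) * \<i> * z))"

definition theta3 :: "complex \<Rightarrow> complex \<Rightarrow> complex" where
  "theta3 z \<tau> =
     (\<Sum>\<^sub>\<infinity>n\<in>(UNIV :: int set). qpow \<tau> (of_int (n\<^sup>2)) * exp (of_int (2 * n) * \<i> * z))"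

definition theta4 :: "complex \<Rightarrow> complex \<Rightarrow> complex" where
  "theta4 z \<tau> =
     (\<Sum>\<^sub>\<infinity>n\<in>(UNIV :: int set).
        (-1) powi n * qpow \<tau> (of_int (n\<^sup>2)) * exp (of_int (2 * n) * \<i> * z))"

text \<open>Integer tuples of lengths \<open>a\<close> and \<open>b\<close> are extensional functions on \<open>{..<a}\<close> and \<open>{..<b}\<close>,
  so that each tuple is counted exactly once, also when \<open>a = 0\<close> or \<open>b = 0\<close>.\<close>

definition zero_sum_tuples :: "nat \<Rightarrow> nat \<Rightarrow> ((nat \<Rightarrow> int) \<times> (nat \<Rightarrow> int)) set" where
  "zero_sum_tuples a b =
     {(r, s) \<in> ({..<a} \<rightarrow>\<^sub>E UNIV) \<times> ({..<b} \<rightarrow>\<^sub>E UNIV).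
        2 * ((\<Sum>i<a. r i) + (\<Sum>j<b. s j)) + int a = 0}"

definition R24 ::
  "nat \<Rightarrow> nat \<Rightarrow> complex \<Rightarrow> complex \<Rightarrow> nat \<Rightarrow> nat \<Rightarrow> complex \<Rightarrow> complex" where
  "R24 a b x y m n \<tau> = of_nat (m * n) * qpow \<tau> (real a / 4) *
     (\<Sum>\<^sub>\<infinity>(r, s)\<in>zero_sum_tuples a b.
        (-1) powi (\<Sum>j<b. s j) *
        qpow \<tau> (of_int ((\<Sum>i<a. (r i)\<^sup>2) + (\<Sum>j<b. (s j)\<^sup>2) + (\<Sum>i<a. r i))) *
        exp (\<i> * (2 * of_int (\<Sum>i<a. r i) * x + 2 * of_int (\<Sum>j<b. s j) * y + of_nat a * x)))"

definition S24 ::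
  "nat \<Rightarrow> nat \<Rightarrow> complex \<Rightarrow> complex \<Rightarrow> nat \<Rightarrow> nat \<Rightarrow> complex \<Rightarrow> complex \<Rightarrow> complex" where
  "S24 a b x y m n \<tau> z =
     (\<Sum>k<m * n.
        theta2 (z + x + of_nat k * complex_of_real pi / of_nat (m * n)) \<tau> ^ a *
        theta4 (z + y + of_nat k * complex_of_real pi / of_nat (m * n)) \<tau> ^ b)"

end

theory Submission
  imports Defs
begin

text \<open>
  Multiplying out \<open>\<theta>\<^sub>2\<^sup>a \<theta>\<^sub>4\<^sup>b\<close> gives an absolutely convergent sum over integer tuples \<open>(r, s)\<close>, in
  which \<open>z\<close> enters only through \<open>exp (2 \<i> N z)\<close> with \<open>N = \<Sum> r + \<Sum> s + a/2\<close>. Averaging over the shifts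
  \<open>k \<pi> / (m n)\<close> kills all tuples except those with \<open>m n\<close> dividing \<open>N\<close>. If \<open>N = m n l\<close>, subtracting \<open>m l\<close>
  from all \<open>n\<close> entries gives a tuple with \<open>N = 0\<close>; since then the cross terms in the quadratic form
  vanish and \<open>a x + b y = 0\<close>, the summand only changes by the factor
  \<open>(-1)\<^bsup>m b l\<^esup> q\<^bsup>m\<^sup>2 n l\<^sup>2\<^esup> exp (2 \<i> m n l z)\<close>, and the double sum over \<open>l\<close> and the tuples with \<open>N = 0\<close> factors.
\<close>

no_notation Infinite_Set_Sum.abs_summable_on (infix \<open>abs'_summable'_on\<close> 50)

section \<open>Absolutely summable families\<close>

lemma has_sum_sum:
  fixes f :: "'i \<Rightarrow> 'a \<Rightarrow> complex"
  assumes "\<And>i. i \<in> I \<Longrightarrow> (f i has_sum g i) A"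
  shows "((\<lambda>x. \<Sum>i\<in>I. f i x) has_sum (\<Sum>i\<in>I. g i)) A"
  using assms by (induction I rule: infinite_finite_induct) (auto intro: has_sum_add has_sum_0)

text \<open>Norms factor, so for fixed \<open>x\<close> the inner sum of norms is
  \<open>norm (f x)\<close> times a constant, and the iterated criterion for absolute summability
  applies.\<close>

lemma abs_summable_on_Times_mult:
  fixes f :: "'a \<Rightarrow> complex" and g :: "'b \<Rightarrow> complex"
  assumes "f abs_summable_on A" and "g abs_summable_on B"
  shows "(\<lambda>(x, y). f x * g y) abs_summable_on A \<times> B"
proof (subst Infinite_Sum.abs_summable_on_Sigma_iff, intro conjI ballI)
  show "(\<lambda>y. case (x, y) of (x, y) \<Rightarrow> f x * g y) abs_summable_on B" for x
    using assms(2) by (simp add: norm_mult summable_on_cmult_right)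
  show "(\<lambda>x. \<Sum>\<^sub>\<infinity>y\<in>B. norm (case (x, y) of (x, y) \<Rightarrow> f x * g y)) abs_summable_on A"
    using assms(1)
    by (simp add: norm_mult infsum_cmult_right' summable_on_cmult_left abs_mult)
qed

lemma infsum_Times_mult:
  fixes f :: "'a \<Rightarrow> complex" and g :: "'b \<Rightarrow> complex"
  assumes "f abs_summable_on A" and "g abs_summable_on B"
  shows "(\<Sum>\<^sub>\<infinity>(x, y)\<in>A \<times> B. f x * g y) = infsum f A * infsum g B"
proof -
  have "(\<Sum>\<^sub>\<infinity>(x, y)\<in>A \<times> B. f x * g y) = (\<Sum>\<^sub>\<infinity>x\<in>A. \<Sum>\<^sub>\<infinity>y\<in>B. f x * g y)"
    using infsum_Sigma_banach[OF abs_summable_summable[OF abs_summable_on_Times_mult[OF assms]]]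
    by simp
  then show ?thesis
    by (simp add: infsum_cmult_right' infsum_cmult_left')
qed

text \<open>Induction on \<open>A\<close>: updating at \<open>x\<close> maps
  \<open>B x \<times> PiE F B\<close> bijectively onto \<open>PiE (insert x F) B\<close>, so one
  more factor is an instance of the two-factor case.\<close>

lemma abs_summable_on_prod_PiE:
  fixes f :: "'a \<Rightarrow> 'b \<Rightarrow> complex"
  assumes "finite A" and "\<And>x. x \<in> A \<Longrightarrow> f x abs_summable_on B x"
  shows "(\<lambda>g. \<Prod>x\<in>A. f x (g x)) abs_summable_on PiE A B"
  using assms
proof (induction A rule: finite_induct)
  case empty
  then show ?case by simp
next
  case (insert x F)
  have "(\<lambda>(y, g). f x y * (\<Prod>x\<in>F. f x (g x))) abs_summable_on B x \<times> PiE F B"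
    using insert by (intro abs_summable_on_Times_mult) auto
  also have "?this \<longleftrightarrow> (\<lambda>(y, g). \<Prod>x'\<in>insert x F. f x' ((g(x := y)) x')) abs_summable_on B x \<times> PiE F B"
  proof (intro summable_on_cong)
    fix p assume "p \<in> B x \<times> PiE F B"
    have "(\<Prod>x'\<in>F. f x' (((snd p)(x := fst p)) x')) = (\<Prod>x'\<in>F. f x' (snd p x'))"
      using insert.hyps by (intro prod.cong) auto
    then show "norm (case p of (y, g) \<Rightarrow> f x y * (\<Prod>x\<in>F. f x (g x))) =
        norm (case p of (y, g) \<Rightarrow> \<Prod>x'\<in>insert x F. f x' ((g(x := y)) x'))"
      using insert.hyps by (simp add: case_prod_unfold)
  qed
  also have "\<dots> \<longleftrightarrow> (\<lambda>g. \<Prod>x'\<in>insert x F. f x' (g x')) abs_summable_on PiE (insert x F) B"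
    unfolding PiE_insert_eq
    by (subst summable_on_reindex[OF inj_combinator])
       (use insert.hyps in \<open>auto simp: o_def case_prod_unfold\<close>)
  finally show ?case .
qed

section \<open>Gaussian sums over the integers\<close>

lemma summable_on_int_exp_minus_abs: "(\<lambda>n::int. exp (- \<bar>real_of_int n\<bar>)) summable_on UNIV"
proof -
  have nat: "(\<lambda>n::nat. exp (- real n)) summable_on UNIV"
  proof (rule norm_summable_imp_summable_on)
    have "summable (\<lambda>n. exp (-1 :: real) ^ n)"
      by (intro summable_geometric) simp
    then show "summable (\<lambda>n. norm (exp (- real n)))"
      by (simp add: exp_of_nat_mult[symmetric])
  qed
  have "(\<lambda>n::int. exp (- \<bar>real_of_int n\<bar>)) summable_on range int"
    using nat by (subst summable_on_reindex) (auto simp: o_def)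
  moreover have "(\<lambda>n::int. exp (- \<bar>real_of_int n\<bar>)) summable_on range (\<lambda>n. - int n)"
    using nat by (subst summable_on_reindex) (auto simp: o_def inj_def)
  \<comment> \<open>The two half-lines share \<open>0\<close>; this is harmless because only
    summability is claimed, not a value.\<close>
  ultimately have "(\<lambda>n::int. exp (- \<bar>real_of_int n\<bar>)) summable_on range int \<union> range (\<lambda>n. - int n)"
    by (rule summable_on_union)
  moreover have "range int \<union> range (\<lambda>n. - int n) = UNIV"
  proof (intro set_eqI iffI UNIV_I)
    show "n \<in> range int \<union> range (\<lambda>n. - int n)" for n
      by (cases n rule: int_cases2) auto
  qed
  ultimately show ?thesis by simp
qed

text \<open>Completing the square bounds the Gaussian by a constant multiple of
  \<open>exp (- \<bar>n\<bar>)\<close>.\<close>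

lemma summable_on_int_gaussian:
  fixes A B C :: real
  assumes "A > 0"
  shows "(\<lambda>n::int. exp (- A * (of_int n)\<^sup>2 + B * of_int n + C)) summable_on UNIV"
proof (rule summable_on_comparison_test)
  \<comment> \<open>\<open>K\<close> is the maximum over real \<open>t\<close> of
    \<open>- A * t^2 + (\<bar>B\<bar> + 1) * t + C\<close>, attained at
    \<open>t = (\<bar>B\<bar> + 1) / (2 * A)\<close>; the extra \<open>1\<close> pays for the decay
    \<open>exp (- t)\<close>.\<close>
  define K where "K = C + (\<bar>B\<bar> + 1)\<^sup>2 / (4 * A)"
  show "(\<lambda>n::int. exp K * exp (- \<bar>real_of_int n\<bar>)) summable_on UNIV"
    by (intro summable_on_cmult_right summable_on_int_exp_minus_abs)
  fix n :: int
  define t where "t = \<bar>real_of_int n\<bar>"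
  have "0 \<le> A * (t - (\<bar>B\<bar> + 1) / (2 * A))\<^sup>2"
    using assms by simp
  also have "\<dots> = A * t\<^sup>2 - (\<bar>B\<bar> + 1) * t + (\<bar>B\<bar> + 1)\<^sup>2 / (4 * A)"
    using assms by (simp add: power2_eq_square field_simps)
  finally have "- A * t\<^sup>2 + \<bar>B\<bar> * t + C \<le> K - t"
    by (simp add: K_def algebra_simps)
  moreover have "B * of_int n \<le> \<bar>B\<bar> * t"
    unfolding t_def by (metis abs_ge_self abs_mult)
  moreover have "t\<^sup>2 = (of_int n)\<^sup>2"
    by (simp add: t_def)
  ultimately show "exp (- A * (of_int n)\<^sup>2 + B * of_int n + C) \<le> exp K * exp (- \<bar>real_of_int n\<bar>)"
    unfolding mult_exp_exp by (simp add: t_def)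
qed auto

section \<open>Products of theta series\<close>

lemma qpow_add: "qpow \<tau> (\<alpha> + \<beta>) = qpow \<tau> \<alpha> * qpow \<tau> \<beta>"
  by (simp add: qpow_def algebra_simps exp_add)

lemma qpow_of_nat_mult: "qpow (of_nat k * \<tau>) \<alpha> = qpow \<tau> (of_nat k * \<alpha>)"
  by (simp add: qpow_def mult_ac)

lemma norm_qpow: "norm (qpow \<tau> \<alpha>) = exp (- pi * Im \<tau> * \<alpha>)"
  by (simp add: qpow_def mult_ac)

text \<open>The constant \<open>qpow \<tau> (1/4)\<close> is moved inside the series, so that powers
  of \<open>theta2\<close> expand into plain products of terms. The total exponent of
  \<open>q\<close> is then \<open>(n + 1/2)^2\<close>.\<close>

definition theta2_term :: "complex \<Rightarrow> complex \<Rightarrow> int \<Rightarrow> complex" where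
  "theta2_term \<tau> w n =
     qpow \<tau> (1/4) * (qpow \<tau> (of_int (n * (n + 1))) * exp (of_int (2 * n + 1) * \<i> * w))"

definition theta4_term :: "complex \<Rightarrow> complex \<Rightarrow> int \<Rightarrow> complex" where
  "theta4_term \<tau> w n =
     (-1) powi n * qpow \<tau> (of_int (n\<^sup>2)) * exp (of_int (2 * n) * \<i> * w)"

lemma theta2_eq_infsum: "theta2 w \<tau> = infsum (theta2_term \<tau> w) UNIV"
  by (simp add: theta2_def theta2_term_def [abs_def] infsum_cmult_right')

lemma theta4_eq_infsum: "theta4 w \<tau> = infsum (theta4_term \<tau> w) UNIV"
  by (simp add: theta4_def theta4_term_def [abs_def])

lemma abs_summable_theta2_term:
  assumes "Im \<tau> > 0"
  shows "theta2_term \<tau> w abs_summable_on UNIV"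
proof -
  have "norm (theta2_term \<tau> w n) =
      exp (- (pi * Im \<tau>) * (of_int n)\<^sup>2 + (- (pi * Im \<tau>) - 2 * Im w) * of_int n
        + (- (pi * Im \<tau>) / 4 - Im w))" for n
    unfolding theta2_term_def norm_mult norm_qpow norm_exp_eq_Re mult_exp_exp
    by (simp add: power2_eq_square algebra_simps)
  then show ?thesis
    using summable_on_int_gaussian[of "pi * Im \<tau>"] assms by simp
qed

lemma norm_minus_one_powi [simp]: "norm ((-1 :: complex) powi k) = 1"
  by (simp add: norm_power_int)

lemma abs_summable_theta4_term:
  assumes "Im \<tau> > 0"
  shows "theta4_term \<tau> w abs_summable_on UNIV"
proof -
  have norm: "norm (theta4_term \<tau> w n) =
      exp (- (pi * Im \<tau>) * (of_int n)\<^sup>2 + (- 2 * Im w) * of_int n + 0)" for n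
    unfolding theta4_term_def norm_mult norm_qpow norm_exp_eq_Re norm_minus_one_powi mult_1 mult_exp_exp
    by (simp add: power2_eq_square algebra_simps)
  show ?thesis
    unfolding norm using assms by (intro summable_on_int_gaussian) simp
qed

lemma prod_theta2_term:
  "(\<Prod>i<a. theta2_term \<tau> w (r i)) =
     qpow \<tau> (real a / 4) * qpow \<tau> (of_int ((\<Sum>i<a. (r i)\<^sup>2) + (\<Sum>i<a. r i))) *
     exp (of_int (2 * (\<Sum>i<a. r i) + int a) * \<i> * w)"
proof (induction a)
  case 0
  then show ?case by (simp add: qpow_def)
next
  case (Suc a)
  then show ?case
    by (simp add: theta2_term_def qpow_def mult_exp_exp)
       (simp add: algebra_simps power2_eq_square add_divide_distrib)
qed

lemma prod_theta4_term:
  fixes s :: "nat \<Rightarrow> int"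
  shows
  "(\<Prod>j<b. theta4_term \<tau> w (s j)) =
     (-1) powi (\<Sum>j<b. s j) * qpow \<tau> (of_int (\<Sum>j<b. (s j)\<^sup>2)) *
     exp (of_int (2 * (\<Sum>j<b. s j)) * \<i> * w)"
proof (induction b)
  case 0
  then show ?case by (simp add: qpow_def)
next
  case (Suc b)
  then show ?case
    by (simp add: theta4_term_def qpow_def power_int_add mult_exp_exp)
       (simp add: algebra_simps exp_add)
qed


text \<open>The summand of \<open>R24\<close> without its prefactor, kept meaningful for all tuples
  because it also occurs in the unrestricted expansion of the theta product.\<close>

definition R24_term ::
  "nat \<Rightarrow> nat \<Rightarrow> complex \<Rightarrow> complex \<Rightarrow> complex \<Rightarrow> (nat \<Rightarrow> int) \<Rightarrow> (nat \<Rightarrow> int) \<Rightarrow> complex" where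
  "R24_term a b x y \<tau> r s =
     (-1) powi (\<Sum>j<b. s j) *
     qpow \<tau> (of_int ((\<Sum>i<a. (r i)\<^sup>2) + (\<Sum>j<b. (s j)\<^sup>2) + (\<Sum>i<a. r i))) *
     exp (\<i> * (2 * of_int (\<Sum>i<a. r i) * x + 2 * of_int (\<Sum>j<b. s j) * y + of_nat a * x))"

definition int_tuples :: "nat \<Rightarrow> nat \<Rightarrow> ((nat \<Rightarrow> int) \<times> (nat \<Rightarrow> int)) set" where
  "int_tuples a b = ({..<a} \<rightarrow>\<^sub>E UNIV) \<times> ({..<b} \<rightarrow>\<^sub>E UNIV)"

text \<open>The exponent is linear in the arguments, so \<open>x\<close> and \<open>y\<close>
  separate from the common part \<open>w\<close>, which is multiplied only by the total
  index.\<close>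

lemma prod_theta_terms:
  "(\<Prod>i<a. theta2_term \<tau> (w + x) (r i)) * (\<Prod>j<b. theta4_term \<tau> (w + y) (s j)) =
     qpow \<tau> (real a / 4) * R24_term a b x y \<tau> r s *
     exp (of_int (2 * ((\<Sum>i<a. r i) + (\<Sum>j<b. s j)) + int a) * \<i> * w)"
proof -
  define R S :: complex where "R = of_int (\<Sum>i<a. r i)" and "S = of_int (\<Sum>j<b. s j)"
  have "exp (of_int (2 * (\<Sum>i<a. r i) + int a) * \<i> * (w + x)) *
      exp (of_int (2 * (\<Sum>j<b. s j)) * \<i> * (w + y)) =
    exp (\<i> * (2 * R * x + 2 * S * y + of_nat a * x)) * exp ((2 * (R + S) + of_nat a) * \<i> * w)"
    unfolding mult_exp_exp R_def S_def by (rule arg_cong[where f = exp]) (simp add: algebra_simps)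
  then show ?thesis
    unfolding prod_theta2_term prod_theta4_term R24_term_def R_def S_def of_int_add qpow_add
    by (simp add: mult_ac)
qed

text \<open>A power of an absolutely convergent series is the sum over tuples of products of terms;
  multiplying the two powers gives the sum over pairs of tuples.\<close>

lemma theta_product_expansion:
  fixes \<tau> x y :: complex and a b :: nat
  assumes "Im \<tau> > 0"
  defines "t \<equiv> \<lambda>w (r, s). qpow \<tau> (real a / 4) * R24_term a b x y \<tau> r s *
             exp (of_int (2 * ((\<Sum>i<a. r i) + (\<Sum>j<b. s j)) + int a) * \<i> * w)"
  shows "t w abs_summable_on int_tuples a b"
    and "(t w has_sum theta2 (w + x) \<tau> ^ a * theta4 (w + y) \<tau> ^ b) (int_tuples a b)"
proof -
  have t: "t w = (\<lambda>(r, s). (\<Prod>i<a. theta2_term \<tau> (w + x) (r i)) * (\<Prod>j<b. theta4_term \<tau> (w + y) (s j)))"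
    by (simp add: t_def prod_theta_terms)
  note sum2 = abs_summable_theta2_term[OF assms(1)] and sum4 = abs_summable_theta4_term[OF assms(1)]
  note A = abs_summable_on_prod_PiE[OF finite_lessThan[of a] sum2[of "w + x"]]
  note B = abs_summable_on_prod_PiE[OF finite_lessThan[of b] sum4[of "w + y"]]
  show sum: "t w abs_summable_on int_tuples a b"
    unfolding t int_tuples_def by (rule abs_summable_on_Times_mult[OF A B])
  have "infsum (t w) (int_tuples a b) = theta2 (w + x) \<tau> ^ a * theta4 (w + y) \<tau> ^ b"
    unfolding t int_tuples_def
    by (subst infsum_Times_mult[OF A B],
        subst infsum_prod_PiE_abs[OF finite_lessThan sum2],
        subst infsum_prod_PiE_abs[OF finite_lessThan sum4])
       (simp add: theta2_eq_infsum theta4_eq_infsum)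
  then show "(t w has_sum theta2 (w + x) \<tau> ^ a * theta4 (w + y) \<tau> ^ b) (int_tuples a b)"
    using has_sum_infsum[OF abs_summable_summable[OF sum]] by simp
qed

section \<open>Averaging and shifting\<close>

text \<open>A geometric sum in \<open>\<omega>\<close>, which satisfies
  \<open>\<omega> ^ M = 1\<close> and equals \<open>1\<close> exactly when \<open>M\<close> divides
  \<open>N\<close>.\<close>

lemma sum_exp_roots_of_unity:
  fixes M :: nat and N :: int
  assumes "M > 0"
  shows "(\<Sum>k<M. exp (of_int (2 * N) * \<i> * (of_nat k * of_real pi / of_nat M))) =
     (if int M dvd N then of_nat M else (0 :: complex))"
proof -
  define \<omega> :: complex where "\<omega> = exp (of_int (2 * N) * \<i> * (of_real pi / of_nat M))"
  have pow: "exp (of_int (2 * N) * \<i> * (of_nat k * of_real pi / of_nat M)) = \<omega> ^ k" for k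
    unfolding \<omega>_def exp_of_nat_mult[symmetric] by (simp add: mult_ac)
  have one: "\<omega> = 1 \<longleftrightarrow> int M dvd N"
  proof -
    have "\<omega> = 1 \<longleftrightarrow> (\<exists>n::int. 2 * real_of_int N * pi / real M = of_int (2 * n) * pi)"
      unfolding \<omega>_def exp_eq_1 by (simp add: Re_divide_of_nat Im_divide_of_nat)
    also have "\<dots> \<longleftrightarrow> (\<exists>n::int. real_of_int N = real_of_int (int M * n))"
      using assms by (intro ex_cong1) (auto simp: field_simps)
    also have "\<dots> \<longleftrightarrow> int M dvd N"
      unfolding of_int_eq_iff dvd_def ..
    finally show ?thesis .
  qed
  have "\<omega> ^ M = exp (2 * of_int N * of_real pi * \<i>)"
    using assms by (simp add: \<omega>_def exp_of_nat_mult[symmetric] mult_ac)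
  also have "\<dots> = 1"
    using exp_integer_2pi[OF Ints_of_int[of N]] by (simp add: mult_ac)
  finally have "\<omega> ^ M = 1" .
  then show ?thesis
    unfolding pow using one by (simp add: sum_gp_strict)
qed

section \<open>Translating integer tuples by a constant\<close>

text \<open>The restricted abstractions keep the shifted tuples extensional, so that the shift by
  \<open>- c\<close> is an exact inverse on \<open>int_tuples a b\<close>.\<close>

definition shift_tuples ::
  "nat \<Rightarrow> nat \<Rightarrow> int \<Rightarrow> (nat \<Rightarrow> int) \<times> (nat \<Rightarrow> int) \<Rightarrow> (nat \<Rightarrow> int) \<times> (nat \<Rightarrow> int)" where
  "shift_tuples a b c = (\<lambda>(r, s). (\<lambda>i\<in>{..<a}. r i + c, \<lambda>j\<in>{..<b}. s j + c))"

lemma shift_tuples_in_int_tuples: "shift_tuples a b c p \<in> int_tuples a b"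
  by (auto simp: shift_tuples_def int_tuples_def case_prod_unfold)

lemma shift_tuples_shift_tuples:
  assumes "p \<in> int_tuples a b"
  shows "shift_tuples a b (- c) (shift_tuples a b c p) = p"
  using assms by (cases p) (auto simp: shift_tuples_def int_tuples_def PiE_def extensional_def fun_eq_iff)

text \<open>The exponent of \<open>q\<close> grows by \<open>(a + b) * c^2\<close> plus
  \<open>c\<close> times the left side of the first assumption: the linear part
  \<open>\<Sum> r\<close> supplies the summand \<open>a * c\<close>. The phase changes by
  \<open>2 * c * (a * x + b * y) = 0\<close>, and the sign by one factor \<open>(-1)^c\<close> for
  each of the \<open>b\<close> entries of \<open>s\<close>.\<close>

lemma R24_term_shift:
  assumes "2 * ((\<Sum>i<a. r i) + (\<Sum>j<b. s j)) + int a = 0"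
    and "of_nat a * x + of_nat b * y = 0"
  shows "R24_term a b x y \<tau> (\<lambda>i\<in>{..<a}. r i + c) (\<lambda>j\<in>{..<b}. s j + c) =
     R24_term a b x y \<tau> r s * ((-1) powi (int b * c) * qpow \<tau> (of_int (int (a + b) * c\<^sup>2)))"
proof -
  define R S where "R = (\<Sum>i<a. r i)" and "S = (\<Sum>j<b. s j)"
  define R2 S2 where "R2 = (\<Sum>i<a. (r i)\<^sup>2)" and "S2 = (\<Sum>j<b. (s j)\<^sup>2)"
  have sums: "(\<Sum>i<a. (\<lambda>i\<in>{..<a}. r i + c) i) = R + int a * c"
    "(\<Sum>j<b. (\<lambda>j\<in>{..<b}. s j + c) j) = S + int b * c"
    "(\<Sum>i<a. ((\<lambda>i\<in>{..<a}. r i + c) i)\<^sup>2) = R2 + 2 * c * R + int a * c\<^sup>2"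
    "(\<Sum>j<b. ((\<lambda>j\<in>{..<b}. s j + c) j)\<^sup>2) = S2 + 2 * c * S + int b * c\<^sup>2"
    by (simp_all add: R_def S_def R2_def S2_def power2_sum sum.distrib sum_distrib_left mult_ac)
  have "R2 + 2 * c * R + int a * c\<^sup>2 + (S2 + 2 * c * S + int b * c\<^sup>2) + (R + int a * c) =
      R2 + S2 + R + int (a + b) * c\<^sup>2 + c * (2 * (R + S) + int a)"
    by (simp add: algebra_simps)
  then have quad: "R2 + 2 * c * R + int a * c\<^sup>2 + (S2 + 2 * c * S + int b * c\<^sup>2) + (R + int a * c) =
      R2 + S2 + R + int (a + b) * c\<^sup>2"
    using assms(1) by (simp add: R_def S_def)
  have "2 * of_int (R + int a * c) * x + 2 * of_int (S + int b * c) * y + of_nat a * x =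
      2 * of_int R * x + 2 * of_int S * y + of_nat a * x + 2 * of_int c * (of_nat a * x + of_nat b * y)"
    by (simp add: algebra_simps)
  then have lin: "2 * of_int (R + int a * c) * x + 2 * of_int (S + int b * c) * y + of_nat a * x =
      2 * of_int R * x + 2 * of_int S * y + of_nat a * x"
    using assms(2) by simp
  show ?thesis
    unfolding R24_term_def sums quad lin R_def[symmetric] S_def[symmetric] R2_def[symmetric] S2_def[symmetric]
    \<comment> \<open>Only the new summand is split off, so that \<open>qpow_add\<close> leaves the
      original exponent in one piece.\<close>
    unfolding of_int_add[where 'a = real, of _ "int (a + b) * c\<^sup>2"] qpow_add
    by (simp add: power_int_add mult_ac)
qed

text \<open>A shift by \<open>m * l\<close> raises the index \<open>N\<close> by
  \<open>m * (a + b) * l\<close>. Hence each tuple whose index is divisible by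
  \<open>m * (a + b)\<close> is a unique shift of a tuple of index \<open>0\<close>.\<close>

lemma infsum_shift_tuples:
  fixes f :: "(nat \<Rightarrow> int) \<times> (nat \<Rightarrow> int) \<Rightarrow> complex"
  assumes "even a" and "m > 0" and "a + b > 0"
  shows "(\<Sum>\<^sub>\<infinity>p\<in>{(r, s) \<in> int_tuples a b.
             int (m * (a + b)) dvd (\<Sum>i<a. r i) + (\<Sum>j<b. s j) + int (a div 2)}. f p) =
         (\<Sum>\<^sub>\<infinity>(l, p)\<in>UNIV \<times> zero_sum_tuples a b. f (shift_tuples a b (int m * l) p))"
proof -
  define N :: "(nat \<Rightarrow> int) \<times> (nat \<Rightarrow> int) \<Rightarrow> int"
    where "N = (\<lambda>(r, s). (\<Sum>i<a. r i) + (\<Sum>j<b. s j) + int (a div 2))"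
  define M where "M = int (m * (a + b))"
  have "M > 0"
    unfolding M_def using assms by (metis nat_0_less_mult_iff of_nat_0_less_iff)
  have N_shift: "N (shift_tuples a b (int m * l) p) = N p + M * l" for l p
    by (simp add: N_def M_def shift_tuples_def case_prod_unfold sum.distrib algebra_simps)
  \<comment> \<open>The defining condition reads \<open>2 * N p = 0\<close>; evenness of
    \<open>a\<close> makes \<open>a div 2\<close> exact.\<close>
  have zero: "zero_sum_tuples a b = {p \<in> int_tuples a b. N p = 0}"
    using assms(1) by (auto simp: zero_sum_tuples_def int_tuples_def N_def elim!: evenE)
  have "{(r, s) \<in> int_tuples a b. int (m * (a + b)) dvd (\<Sum>i<a. r i) + (\<Sum>j<b. s j) + int (a div 2)} =
      {p \<in> int_tuples a b. M dvd N p}"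
    by (auto simp: N_def M_def)
  moreover have "(\<Sum>\<^sub>\<infinity>p\<in>{p \<in> int_tuples a b. M dvd N p}. f p) =
      (\<Sum>\<^sub>\<infinity>(l, p)\<in>UNIV \<times> {p \<in> int_tuples a b. N p = 0}. f (shift_tuples a b (int m * l) p))"
  \<comment> \<open>The inverse reads off \<open>l\<close> as the quotient \<open>N p div M\<close>
    and shifts back by \<open>m * l\<close>.\<close>
  proof (rule infsum_reindex_bij_witness[symmetric,
        where j = "\<lambda>(l, p). shift_tuples a b (int m * l) p"
          and i = "\<lambda>p. (N p div M, shift_tuples a b (int m * - (N p div M)) p)"])
    fix q assume "q \<in> (UNIV :: int set) \<times> {p \<in> int_tuples a b. N p = 0}"
    then obtain l p where q: "q = (l, p)" "p \<in> int_tuples a b" "N p = 0"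
      by auto
    show "(N (case q of (l, p) \<Rightarrow> shift_tuples a b (int m * l) p) div M,
        shift_tuples a b (int m * - (N (case q of (l, p) \<Rightarrow> shift_tuples a b (int m * l) p) div M))
          (case q of (l, p) \<Rightarrow> shift_tuples a b (int m * l) p)) = q"
      using q \<open>M > 0\<close> by (simp add: N_shift shift_tuples_shift_tuples)
    show "(case q of (l, p) \<Rightarrow> shift_tuples a b (int m * l) p) \<in> {p \<in> int_tuples a b. M dvd N p}"
      using q by (simp add: N_shift shift_tuples_in_int_tuples)
    show "f (case q of (l, p) \<Rightarrow> shift_tuples a b (int m * l) p) =
        (case q of (l, p) \<Rightarrow> f (shift_tuples a b (int m * l) p))"
      by (simp add: q)
  next
    fix p assume "p \<in> {p \<in> int_tuples a b. M dvd N p}"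
    then have p: "p \<in> int_tuples a b" "M dvd N p"
      by auto
    show "(N p div M, shift_tuples a b (int m * - (N p div M)) p) \<in> UNIV \<times> {p \<in> int_tuples a b. N p = 0}"
      using p N_shift[of "- (N p div M)" p] by (simp add: shift_tuples_in_int_tuples)
    show "(case (N p div M, shift_tuples a b (int m * - (N p div M)) p) of
        (l, p) \<Rightarrow> shift_tuples a b (int m * l) p) = p"
      using shift_tuples_shift_tuples[OF p(1), of "- (int m * (N p div M))"] by simp
  qed
  ultimately show ?thesis
    unfolding zero by simp
qed

section \<open>Assembling the identity\<close>

text \<open>At \<open>w = 0\<close> the exponential in the theta expansion is \<open>1\<close>, and
  the nonzero constant \<open>qpow \<tau> (real a / 4)\<close> can be divided out.\<close>

lemma abs_summable_R24_term:
  assumes "Im \<tau> > 0"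
  shows "(\<lambda>(r, s). R24_term a b x y \<tau> r s) abs_summable_on int_tuples a b"
proof -
  have "(\<lambda>(r, s). qpow \<tau> (real a / 4) * R24_term a b x y \<tau> r s) abs_summable_on int_tuples a b"
    using theta_product_expansion(1)[OF assms, of a b x y 0] by (simp add: case_prod_unfold)
  then have "(\<lambda>p. norm (qpow \<tau> (real a / 4)) * norm (case p of (r, s) \<Rightarrow> R24_term a b x y \<tau> r s))
      summable_on int_tuples a b"
    by (simp add: case_prod_unfold norm_mult)
  moreover have "norm (qpow \<tau> (real a / 4)) \<noteq> 0"
    by (simp add: qpow_def)
  ultimately show ?thesis
    by (metis (no_types, lifting) summable_on_cmult_right' summable_on_cong)
qed

text \<open>The finite sum over \<open>k\<close> is exchanged with the sum over tuples; each tuple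
  then carries a sum of roots of unity, which is \<open>m * n\<close> or \<open>0\<close>.\<close>

lemma S24_eq_infsum_dvd:
  assumes "Im \<tau> > 0" and "m > 0" and "n > 0" and "even a"
  shows "S24 a b x y m n \<tau> z =
    (\<Sum>\<^sub>\<infinity>(r, s)\<in>{(r, s) \<in> int_tuples a b.
             int (m * n) dvd (\<Sum>i<a. r i) + (\<Sum>j<b. s j) + int (a div 2)}.
       of_nat (m * n) * qpow \<tau> (real a / 4) * R24_term a b x y \<tau> r s *
         exp (of_int (2 * ((\<Sum>i<a. r i) + (\<Sum>j<b. s j)) + int a) * \<i> * z))"
proof -
  define e where "e = (\<lambda>w (r, s). exp (of_int (2 * ((\<Sum>i<a. r i) + (\<Sum>j<b. s j)) + int a) * \<i> * w))"
  define A where "A = (\<lambda>(r, s). qpow \<tau> (real a / 4) * R24_term a b x y \<tau> r s)"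
  define N :: "(nat \<Rightarrow> int) \<times> (nat \<Rightarrow> int) \<Rightarrow> int"
    where "N = (\<lambda>(r, s). (\<Sum>i<a. r i) + (\<Sum>j<b. s j) + int (a div 2))"
  define \<zeta> where "\<zeta> = (\<lambda>k. of_nat k * complex_of_real pi / of_nat (m * n))"
  have expansion: "((\<lambda>p. A p * e w p) has_sum theta2 (w + x) \<tau> ^ a * theta4 (w + y) \<tau> ^ b) (int_tuples a b)" for w
    using theta_product_expansion(2)[OF assms(1), of a b x y w]
    by (simp add: A_def e_def case_prod_unfold)
  have e_N: "e w p = exp (of_int (2 * N p) * \<i> * w)" for w p
    using assms(4) by (auto simp: e_def N_def case_prod_unfold elim!: evenE)
  have e_add: "e (w + w') p = e w p * e w' p" for w w' p
    by (simp add: e_N distrib_left exp_add)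
  have roots: "(\<Sum>k<m * n. e (\<zeta> k) p) = (if int (m * n) dvd N p then of_nat (m * n) else 0)" for p
    unfolding e_N \<zeta>_def using assms(2,3) by (intro sum_exp_roots_of_unity) simp
  have "((\<lambda>p. \<Sum>k<m * n. A p * e (z + \<zeta> k) p) has_sum
      (\<Sum>k<m * n. theta2 (z + \<zeta> k + x) \<tau> ^ a * theta4 (z + \<zeta> k + y) \<tau> ^ b)) (int_tuples a b)"
    by (intro has_sum_sum expansion)
  moreover have "(\<Sum>k<m * n. theta2 (z + \<zeta> k + x) \<tau> ^ a * theta4 (z + \<zeta> k + y) \<tau> ^ b) = S24 a b x y m n \<tau> z"
    by (simp add: S24_def \<zeta>_def add_ac)
  moreover have "(\<Sum>k<m * n. A p * e (z + \<zeta> k) p) = A p * e z p * (\<Sum>k<m * n. e (\<zeta> k) p)" for p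
    by (simp add: e_add sum_distrib_left mult_ac)
  ultimately have "S24 a b x y m n \<tau> z =
      (\<Sum>\<^sub>\<infinity>p\<in>int_tuples a b. A p * e z p * (if int (m * n) dvd N p then of_nat (m * n) else 0))"
    unfolding roots by (simp add: infsumI)
  also have "\<dots> = (\<Sum>\<^sub>\<infinity>p\<in>{p \<in> int_tuples a b. int (m * n) dvd N p}. of_nat (m * n) * A p * e z p)"
    by (intro infsum_cong_neutral) auto
  finally show ?thesis
    by (simp add: A_def e_def N_def case_prod_unfold mult.assoc)
qed

text \<open>After the reindexing, every summand is a constant times a factor in \<open>l\<close>
  times a factor in the zero-sum tuple, so the double sum factors. The sign is left as a power of
  \<open>(-1)\<close>, which serves both parities of \<open>m * b\<close>.\<close>

lemma S24_eq_R24_times_infsum: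
  assumes "Im \<tau> > 0" and "m > 0" and "n > 0" and "a + b = n" and "even a"
    and "of_nat a * x + of_nat b * y = 0"
  shows "S24 a b x y m n \<tau> z = R24 a b x y m n \<tau> *
    (\<Sum>\<^sub>\<infinity>l\<in>(UNIV :: int set). (-1) powi (int (m * b) * l) *
       qpow (of_nat (m\<^sup>2 * n) * \<tau>) (of_int (l\<^sup>2)) * exp (of_int (2 * l) * \<i> * (of_nat (m * n) * z)))"
proof -
  define H where "H = (\<lambda>(r, s). R24_term a b x y \<tau> r s)"
  define G where "G = (\<lambda>l::int. (-1) powi (int (m * b) * l) *
    qpow (of_nat (m\<^sup>2 * n) * \<tau>) (of_int (l\<^sup>2)) * exp (of_int (2 * l) * \<i> * (of_nat (m * n) * z)))"
  define K where "K = of_nat (m * n) * qpow \<tau> (real a / 4)"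
  define F where "F = (\<lambda>(r, s). K * R24_term a b x y \<tau> r s *
    exp (of_int (2 * ((\<Sum>i<a. r i) + (\<Sum>j<b. s j)) + int a) * \<i> * z))"
  have F_shift: "F (shift_tuples a b (int m * l) p) = K * (G l * H p)"
    if p: "p \<in> zero_sum_tuples a b" for l p
  proof -
    obtain r s where [simp]: "p = (r, s)"
      by (cases p)
    have zero: "2 * ((\<Sum>i<a. r i) + (\<Sum>j<b. s j)) + int a = 0"
      using p by (simp add: zero_sum_tuples_def)
    let ?r = "\<lambda>i\<in>{..<a}. r i + int m * l" and ?s = "\<lambda>j\<in>{..<b}. s j + int m * l"
    have "2 * ((\<Sum>i<a. ?r i) + (\<Sum>j<b. ?s j)) + int a =
        2 * ((\<Sum>i<a. r i) + (\<Sum>j<b. s j)) + int a + 2 * l * int (m * n)"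
      by (simp add: sum.distrib assms(4)[symmetric] algebra_simps)
    then have index: "2 * ((\<Sum>i<a. ?r i) + (\<Sum>j<b. ?s j)) + int a = 2 * l * int (m * n)"
      using zero by simp
    have exponent: "exp (of_int (2 * ((\<Sum>i<a. ?r i) + (\<Sum>j<b. ?s j)) + int a) * \<i> * z) =
        exp (of_int (2 * l) * \<i> * (of_nat (m * n) * z))"
      unfolding index by (simp add: mult_ac)
    \<comment> \<open>With \<open>c = m * l\<close> the new exponent \<open>n * c^2\<close> becomes
      \<open>l^2\<close> for the parameter \<open>m^2 * n * \<tau>\<close>.\<close>
    have "real_of_int (int (a + b) * (int m * l)\<^sup>2) = real (m\<^sup>2 * n) * of_int (l\<^sup>2)"
      by (simp add: assms(4) power_mult_distrib)
    then have "R24_term a b x y \<tau> ?r ?s =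
        H p * ((-1) powi (int (m * b) * l) * qpow (of_nat (m\<^sup>2 * n) * \<tau>) (of_int (l\<^sup>2)))"
      unfolding R24_term_shift[OF zero assms(6)] qpow_of_nat_mult by (simp add: H_def mult_ac)
    then show ?thesis
      unfolding F_def G_def shift_tuples_def \<open>p = (r, s)\<close> prod.case exponent by (simp add: mult_ac)
  qed
  have "zero_sum_tuples a b \<subseteq> int_tuples a b"
    by (auto simp: zero_sum_tuples_def int_tuples_def)
  then have H: "H abs_summable_on zero_sum_tuples a b"
    unfolding H_def by (rule summable_on_subset_banach[OF abs_summable_R24_term[OF assms(1)]])
  have "Im (of_nat (m\<^sup>2 * n) * \<tau>) > 0"
    using assms(1-3) by simp
  \<comment> \<open>The terms of \<open>G\<close> differ from those of this \<open>theta4\<close>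
    series only by signs, so the norms agree.\<close>
  from abs_summable_theta4_term[OF this, of "of_nat (m * n) * z"]
  have G: "G abs_summable_on UNIV"
    unfolding G_def theta4_term_def by (simp add: norm_mult)
  have "S24 a b x y m n \<tau> z =
      (\<Sum>\<^sub>\<infinity>(l, p)\<in>UNIV \<times> zero_sum_tuples a b. F (shift_tuples a b (int m * l) p))"
    unfolding S24_eq_infsum_dvd[OF assms(1,2,3,5)]
      infsum_shift_tuples[OF assms(5,2), of b, unfolded assms(4), OF assms(3), symmetric]
    by (simp add: F_def K_def)
  also have "\<dots> = (\<Sum>\<^sub>\<infinity>(l, p)\<in>UNIV \<times> zero_sum_tuples a b. K * (G l * H p))"
    by (intro infsum_cong) (auto simp: F_shift)
  also have "\<dots> = K * (infsum G UNIV * infsum H (zero_sum_tuples a b))"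
    by (simp add: case_prod_unfold infsum_cmult_right' infsum_Times_mult[OF G H, unfolded case_prod_unfold])
  finally show ?thesis
    unfolding R24_def K_def H_def G_def R24_term_def by (simp add: mult_ac)
qed

theorem theorem3p13:
  fixes m n a b :: nat and x y \<tau> z :: complex
  assumes "Im \<tau> > 0"
    and "m > 0" and "n > 0"
    and "a + b = n" and "even a"
    and "of_nat a * x + of_nat b * y = 0"
  shows "(even (m * b) \<longrightarrow>
            S24 a b x y m n \<tau> z =
              R24 a b x y m n \<tau> * theta3 (of_nat (m * n) * z) (of_nat (m\<^sup>2 * n) * \<tau>))
       \<and> (odd (m * b) \<longrightarrow>
            S24 a b x y m n \<tau> z =
              R24 a b x y m n \<tau> * theta4 (of_nat (m * n) * z) (of_nat (m\<^sup>2 * n) * \<tau>))"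
proof -
  \<comment> \<open>The inner power is \<open>1\<close> or \<open>-1\<close> by the parity of
    \<open>m * b\<close>, giving the signs of \<open>theta3\<close> or of
    \<open>theta4\<close>.\<close>
  have "(-1 :: complex) powi (int (m * b) * l) = ((-1) powi int (m * b)) powi l" for l
    by (rule power_int_mult)
  then have sign: "(-1 :: complex) powi (int (m * b) * l) = (if even (m * b) then 1 else (-1) powi l)" for l
    by (simp add: power_int_of_nat)
  show ?thesis
    unfolding S24_eq_R24_times_infsum[OF assms] theta3_def theta4_def sign by simp
qed

end
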